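(* Let $F:\mathbb{R}^n\rightrightarrows\mathbb{R}^q$ be a polyhedral convex set-valued mapping and let $C\subseteq\mathbb{R}^q$ be an arbitrary polyhedral convex cone (possibly with empty interior). Let (P) have a solution. Then for given $\bar y\in\mathcal{P}$, the procedure $\mathtt{AffineStart}(F,C,\bar y)$ is finite and it computes some $\bar x\in\mathbb{R}^n$ with $\bar y\in F(\bar x)+C$ such that, for the original (unmodified) mapping $F$, there is no $x\in\mathbb{R}^n$ with $$F(x)+C\supseteq F(\bar x)+C\quad\text{and}\quad \dim(F(x)+C)>\dim(F(\bar x)+C).$$
   Context: A set-valued mapping $F:\mathbb{R}^n\rightrightarrows\mathbb{R}^q$ is polyhedral convex if its graph $\mathrm{gr}\,F=\{(x,y)\in\mathbb{R}^n\times\mathbb{R}^q : y\in F(x)\}$ is a convex polyhedron; $\mathrm{dom}\,F=\{x : F(x)\ne\emptyset\}$. Polyhedral convex cones are nonempty (contain $0$). The recession mapping $G:\mathbb{R}^n\rightrightarrows\mathbb{R}^q$ of $F$ is defined by $\mathrm{gr}\,G=0^+\mathrm{gr}\,F$, where $0^+A=\{d : a+td\in A\ \forall a\in A,\ t\ge0\}$ is the recession cone. $\mathrm{aff}$ denotes the affine hull, $\dim$ of a convex set is the dimension of its affine hull, and $(\mathrm{aff}\,Q)^\perp$ is the orthogonal complement of $\mathrm{aff}\,Q$ (of its direction space). Problem (P) is: minimize $F(x)+C$ over $x\in\mathbb{R}^n$ with respect to the ordering $\supseteq$; its upper image is $\mathcal{P}=C+\bigcup_{x\in\mathbb{R}^n}F(x)$.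 A pair $(\bar S,\hat S)$ of finite sets $\emptyset\ne\bar S\subseteq\mathrm{dom}\,F$ and $\hat S\subseteq\mathrm{dom}\,G\setminus\{0\}$ is a finite infimizer of (P) if $\mathcal{P}\subseteq C+\mathrm{conv}\bigcup_{x\in\bar S}F(x)+\mathrm{cone}\bigcup_{x\in\hat S}G(x)$, where $\mathrm{cone}\,Y$ is the smallest convex cone containing $Y$ and $\mathrm{cone}\,\emptyset=\{0\}$. A point $\bar x\in\mathrm{dom}\,F$ is a minimizing point of (P) if there is no $x\in\mathbb{R}^n$ with $F(x)+C\supsetneq F(\bar x)+C$. A nonzero $\hat x\in\mathrm{dom}\,G$ is a minimizing direction of (P) if there is no $x\in\mathbb{R}^n$ with $G(x)+C\supsetneq G(\hat x)+C$. A finite infimizer $(\bar S,\hat S)$ is a solution of (P) if all elements of $\bar S$ are minimizing points and all elements of $\hat S$ (if any) are minimizing directions. Minimal system of outer normals: for a polyhedral convex set $Q\subseteq\mathbb{R}^q$, a family $\{w^1,\dots,w^k\}$ of vectors arising from an inequality representation $Q=\{y : y^Tw^1\le\gamma_1,\dots,y^Tw^k\le\gamma_k\}$ with $\|w^1\|=\dots=\|w^k\|=1$ and $k$ minimal (not necessarily unique if $Q$ has empty interior; empty if $Q=\mathbb{R}^q$). For $\bar x\in\mathrm{dom}\,F$ and $w\in\mathbb{R}^q$, $\mathrm{LP}(F,w,\bar x)$ is the linear program: maximize $w^Ty$ over $(x,y)\in\mathbb{R}^n\times\mathbb{R}^q$ subject to $y\in F(x)+C$ and $F(\bar x)+C\subseteq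 F(x)+C$. Procedure $\mathtt{AffineStart}(F,C,\bar y)$: 1. Choose $\bar x\in\mathbb{R}^n$ with $\bar y\in F(\bar x)+C$. 2. Repeat the following outer loop: let $N$ be a minimal system of outer normals of $\mathrm{aff}(F(\bar x)+C)$. Go through the elements $w\in N$ one by one: let $(x^*,y^* )$ be an optimal solution of $\mathrm{LP}(F,w,\bar x)$; if $y^*\notin\mathrm{aff}(F(\bar x)+C)$, replace $\bar x$ by $x^*$, and immediately start the outer loop again (with the new $\bar x$). If all $w\in N$ have been processed without such a replacement, leave the outer loop. 3. Replace $F$ by the mapping $x\mapsto F(x)+(\mathrm{aff}(F(\bar x)+C))^\perp$. Output the modified mapping $F$ and the point $\bar x$. When (P) has a solution, all linear programs arising in the procedure have optimal solutions. All choices in the procedure are arbitrary. *)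

theory Defs
  imports "HOL-Analysis.Analysis"
begin

(* Sums of sets below are Minkowski sums (theory Set_Algebras). *)

section \<open>Polyhedral convex set-valued mappings\<close>

definition setmap_graph :: "('a \<Rightarrow> 'b set) \<Rightarrow> ('a \<times> 'b) set" where
  "setmap_graph F = {(x, y). y \<in> F x}"

definition setmap_dom :: "('a \<Rightarrow> 'b set) \<Rightarrow> 'a set" where
  "setmap_dom F = {x. F x \<noteq> {}}"

definition polyhedral_map :: "('a::euclidean_space \<Rightarrow> 'b::euclidean_space set) \<Rightarrow> bool" where
  "polyhedral_map F \<longleftrightarrow> polyhedron (setmap_graph F)"

definition polyhedral_cone :: "'b::euclidean_space set \<Rightarrow> bool" where
  "polyhedral_cone C \<longleftrightarrow> polyhedron C \<and> convex_cone C"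

definition recession_cone :: "'a::real_vector set \<Rightarrow> 'a set" where
  "recession_cone A = {d. \<forall>a\<in>A. \<forall>t\<ge>0. a + t *\<^sub>R d \<in> A}"

definition recession_map ::
    "('a::real_vector \<Rightarrow> 'b::real_vector set) \<Rightarrow> 'a \<Rightarrow> 'b set" where
  "recession_map F x = {y. (x, y) \<in> recession_cone (setmap_graph F)}"

section \<open>The set optimization problem\<close>

definition upper_image :: "('a \<Rightarrow> 'b::real_vector set) \<Rightarrow> 'b set \<Rightarrow> 'b set" where
  "upper_image F C = C + (\<Union>x. F x)"

definition finite_infimizer ::
    "('a::real_vector \<Rightarrow> 'b::real_vector set) \<Rightarrow> 'b set \<Rightarrow> 'a set \<Rightarrow> 'a set \<Rightarrow> bool" where
  "finite_infimizer F C Sbar Shat \<longleftrightarrow>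
     finite Sbar \<and> finite Shat \<and> Sbar \<noteq> {} \<and>
     Sbar \<subseteq> setmap_dom F \<and> Shat \<subseteq> setmap_dom (recession_map F) - {0} \<and>
     upper_image F C \<subseteq>
       C + convex hull (\<Union>x\<in>Sbar. F x) + convex_cone hull (\<Union>x\<in>Shat. recession_map F x)"

definition minimizing_point ::
    "('a \<Rightarrow> 'b::real_vector set) \<Rightarrow> 'b set \<Rightarrow> 'a \<Rightarrow> bool" where
  "minimizing_point F C xbar \<longleftrightarrow>
     xbar \<in> setmap_dom F \<and> \<not> (\<exists>x. F x + C \<supset> F xbar + C)"

definition minimizing_direction ::
    "('a::real_vector \<Rightarrow> 'b::real_vector set) \<Rightarrow> 'b set \<Rightarrow> 'a \<Rightarrow> bool" where
  "minimizing_direction F C xhat \<longleftrightarrow>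
     xhat \<noteq> 0 \<and> xhat \<in> setmap_dom (recession_map F) \<and>
     \<not> (\<exists>x. recession_map F x + C \<supset> recession_map F xhat + C)"

definition is_solution ::
    "('a::real_vector \<Rightarrow> 'b::real_vector set) \<Rightarrow> 'b set \<Rightarrow> 'a set \<Rightarrow> 'a set \<Rightarrow> bool" where
  "is_solution F C Sbar Shat \<longleftrightarrow>
     finite_infimizer F C Sbar Shat \<and>
     (\<forall>x\<in>Sbar. minimizing_point F C x) \<and>
     (\<forall>x\<in>Shat. minimizing_direction F C x)"

section \<open>The ingredients of the procedure\<close>

definition normal_representation ::
    "'b::real_inner set \<Rightarrow> 'b list \<Rightarrow> real list \<Rightarrow> bool" where
  "normal_representation Q ws gs \<longleftrightarrow>
     length gs = length ws \<and> (\<forall>w\<in>set ws. norm w = 1) \<and>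
     Q = {y. \<forall>i<length ws. y \<bullet> ws ! i \<le> gs ! i}"

(* A system is a list: any permutation of a minimal system is again one, so choosing a list
   chooses both the family and the order in which it is processed. Minimality refers to the
   number of inequalities, not to inclusion; for an affine subspace of codimension m \<ge> 1
   this number is m + 1. *)
definition minimal_outer_normals :: "'b::real_inner set \<Rightarrow> 'b list \<Rightarrow> bool" where
  "minimal_outer_normals Q ws \<longleftrightarrow>
     (\<exists>gs. normal_representation Q ws gs) \<and>
     (\<forall>ws' gs'. normal_representation Q ws' gs' \<longrightarrow> length ws \<le> length ws')"

definition lp_feasible ::
    "('a \<Rightarrow> 'b::real_vector set) \<Rightarrow> 'b set \<Rightarrow> 'a \<Rightarrow> ('a \<times> 'b) set" where
  "lp_feasible F C xbar = {(x, y). y \<in> F x + C \<and> F xbar + C \<subseteq> F x + C}"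

definition lp_optimal ::
    "('a \<Rightarrow> 'b::real_inner set) \<Rightarrow> 'b set \<Rightarrow> 'b \<Rightarrow> 'a \<Rightarrow> 'a \<times> 'b \<Rightarrow> bool" where
  "lp_optimal F C w xbar p \<longleftrightarrow>
     p \<in> lp_feasible F C xbar \<and>
     (\<forall>p'\<in>lp_feasible F C xbar. w \<bullet> snd p' \<le> w \<bullet> snd p)"

definition aff_orthogonal :: "'b::real_inner set \<Rightarrow> 'b set" where
  "aff_orthogonal Q = orthogonal_comp {u - v | u v. u \<in> affine hull Q \<and> v \<in> affine hull Q}"

section \<open>The procedure AffineStart as a nondeterministic transition system\<close>

(* Outer xbar: about to start the outer loop with the current point xbar.
   Inner xbar ws: inside the outer loop, ws being the normals still to be processed.
   Output F' xbar: terminated, with the modified mapping F' and the point xbar. *)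
datatype ('a, 'b) affine_start_state =
    Start
  | Outer 'a
  | Inner 'a "'b list"
  | Output "'a \<Rightarrow> 'b set" 'a

inductive affine_start_step ::
    "('a \<Rightarrow> 'b::euclidean_space set) \<Rightarrow> 'b set \<Rightarrow> 'b \<Rightarrow>
     ('a, 'b) affine_start_state \<Rightarrow> ('a, 'b) affine_start_state \<Rightarrow> bool"
  for F C ybar where
  choose: "ybar \<in> F xbar + C \<Longrightarrow> affine_start_step F C ybar Start (Outer xbar)"
| normals: "minimal_outer_normals (affine hull (F xbar + C)) N \<Longrightarrow>
    affine_start_step F C ybar (Outer xbar) (Inner xbar N)"
| keep: "lp_optimal F C w xbar (xs, ys) \<Longrightarrow> ys \<in> affine hull (F xbar + C) \<Longrightarrow>
    affine_start_step F C ybar (Inner xbar (w # ws)) (Inner xbar ws)"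
| replace: "lp_optimal F C w xbar (xs, ys) \<Longrightarrow> ys \<notin> affine hull (F xbar + C) \<Longrightarrow>
    affine_start_step F C ybar (Inner xbar (w # ws)) (Outer xs)"
| finish: "affine_start_step F C ybar (Inner xbar [])
    (Output (\<lambda>x. F x + aff_orthogonal (F xbar + C)) xbar)"

definition affine_start_reachable ::
    "('a \<Rightarrow> 'b::euclidean_space set) \<Rightarrow> 'b set \<Rightarrow> 'b \<Rightarrow>
     ('a, 'b) affine_start_state \<Rightarrow> bool" where
  "affine_start_reachable F C ybar = (affine_start_step F C ybar)\<^sup>*\<^sup>* Start"

end

(* Every replacement strictly enlarges the affine hull of F xbar + C, so there are at most q of
   them. When all normals of an outer loop are kept, the linear programs bound w . y over all x
   with F x + C containing F xbar + C by the values attained on the affine hull, so no such F x + C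
   leaves the affine hull.

   The linear programs are solvable: by Fourier-Motzkin elimination the graph of F + C is a
   polyhedron {(x, y). a x + b y <= c}, and F xbar + C is contained in F x + C iff
   a x <= c - sup {b y | y in F xbar + C}, so the feasible set is a polyhedron. If w were unbounded
   on it, Farkas' lemma would give a recession direction (d, e) with w . e > 0. Moving a minimizing
   point along d does not change the value of F + C, so e is a recession direction of that value and
   hence of F xbar + C; but w is bounded on F xbar + C. *)
theory Submission
  imports Defs
begin

section \<open>Fourier-Motzkin elimination: images and sums of polyhedra\<close>

section \<open>Linear images of polyhedra\<close>

text \<open>Pairs of a normal and a bound; a normal may be zero, so systems produced by elimination
  need no filtering.\<close>

lemma polyhedron_inequalities:
  fixes S :: "'a::euclidean_space set"
  shows "polyhedron S \<longleftrightarrow> (\<exists>I. finite I \<and> S = {x. \<forall>p\<in>I. fst p \<bullet> x \<le> snd p})"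
proof
  assume "polyhedron S"
  then obtain H where H: "finite H" "S = \<Inter>H"
    and "\<forall>h\<in>H. \<exists>a b. a \<noteq> 0 \<and> h = {x. a \<bullet> x \<le> b}"
    unfolding polyhedron_def by blast
  then have "\<forall>h\<in>H. \<exists>p. h = {x. fst p \<bullet> x \<le> snd p}"
    by fastforce
  then obtain p where p: "\<And>h. h \<in> H \<Longrightarrow> h = {x. fst (p h) \<bullet> x \<le> snd (p h)}"
    by (metis (no_types))
  have "S = {x. \<forall>q\<in>p ` H. fst q \<bullet> x \<le> snd q}"
    using H(2) p by auto
  with H(1) show "\<exists>I. finite I \<and> S = {x. \<forall>p\<in>I. fst p \<bullet> x \<le> snd p}"
    by (intro exI[of _ "p ` H"]) auto
next
  assume "\<exists>I. finite I \<and> S = {x. \<forall>p\<in>I. fst p \<bullet> x \<le> snd p}"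
  then obtain I where I: "finite I" "S = (\<Inter>p\<in>I. {x. fst p \<bullet> x \<le> snd p})"
    by auto
  then show "polyhedron S"
    by (auto intro!: polyhedron_Inter polyhedron_halfspace_le)
qed

lemma polyhedron_halfspaces:
  fixes a :: "'i \<Rightarrow> 'a::euclidean_space"
  assumes "finite I"
  shows "polyhedron {x. \<forall>i\<in>I. a i \<bullet> x \<le> b i}"
proof -
  have "{x. \<forall>i\<in>I. a i \<bullet> x \<le> b i} = (\<Inter>i\<in>I. {x. a i \<bullet> x \<le> b i})"
    by auto
  then show ?thesis
    using assms by (auto intro!: polyhedron_Inter polyhedron_halfspace_le)
qed

lemma polyhedron_linear_preimage:
  fixes f :: "'a::euclidean_space \<Rightarrow> 'b::euclidean_space"
  assumes "linear f" "polyhedron S"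
  shows "polyhedron {x. f x \<in> S}"
proof -
  obtain I where I: "finite I" "S = {y. \<forall>p\<in>I. fst p \<bullet> y \<le> snd p}"
    using assms(2) by (auto simp: polyhedron_inequalities)
  have "{x. f x \<in> S} = {x. \<forall>p\<in>I. adjoint f (fst p) \<bullet> x \<le> snd p}"
    unfolding I(2) using adjoint_works[OF assms(1)] by (simp only: inner_commute mem_Collect_eq)
  then show ?thesis
    by (simp only: polyhedron_halfspaces[OF I(1)])
qed

text \<open>A negative coefficient gives a lower bound \<open>\<beta> j / \<alpha> j\<close> on
  \<open>t\<close>, a positive one an upper bound. Such a \<open>t\<close> exists iff every lower
  bound is at most every upper bound, written here after cross-multiplication.\<close>

lemma scalar_inequalities_solvable_iff:
  fixes \<alpha> \<beta> :: "'i \<Rightarrow> real"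
  assumes "finite I"
  shows "(\<exists>t. \<forall>i\<in>I. t * \<alpha> i \<le> \<beta> i) \<longleftrightarrow>
    (\<forall>i\<in>I. \<alpha> i = 0 \<longrightarrow> 0 \<le> \<beta> i) \<and>
    (\<forall>i\<in>I. \<forall>j\<in>I. 0 < \<alpha> i \<longrightarrow> \<alpha> j < 0 \<longrightarrow> \<alpha> j * \<beta> i \<le> \<alpha> i * \<beta> j)"
    (is "?L \<longleftrightarrow> ?Z \<and> ?P")
proof
  assume ?L
  then obtain t where t: "\<And>i. i \<in> I \<Longrightarrow> t * \<alpha> i \<le> \<beta> i"
    by blast
  have "\<alpha> j * \<beta> i \<le> \<alpha> i * \<beta> j" if "i \<in> I" "j \<in> I" "0 < \<alpha> i" "\<alpha> j < 0" for i j
  proof -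
    have "\<alpha> j * \<beta> i \<le> \<alpha> j * (t * \<alpha> i)"
      using t[OF that(1)] that(4) by (simp add: mult_left_mono_neg)
    also have "\<dots> = \<alpha> i * (t * \<alpha> j)"
      by simp
    also have "\<dots> \<le> \<alpha> i * \<beta> j"
      using t[OF that(2)] that(3) by (simp add: mult_left_mono)
    finally show ?thesis .
  qed
  moreover have ?Z
    using t by fastforce
  ultimately show "?Z \<and> ?P"
    by blast
next
  assume R: "?Z \<and> ?P"
  let ?N = "{j\<in>I. \<alpha> j < 0}" and ?M = "{i\<in>I. 0 < \<alpha> i}"
  \<comment> \<open>Witness: the largest lower bound, or the smallest upper bound if there is no
    lower one, or anything if there is neither. The cases keep \<open>Max\<close> and
    \<open>Min\<close> away from the empty set.\<close>
  have "\<exists>t. (\<forall>j\<in>?N. \<beta> j / \<alpha> j \<le> t) \<and> (\<forall>i\<in>?M. t \<le> \<beta> i / \<alpha> i)"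
  proof (cases "?N = {}")
    case True
    show ?thesis
    proof (cases "?M = {}")
      case False
      then show ?thesis
        using True assms
        by (intro exI[of _ "Min ((\<lambda>i. \<beta> i / \<alpha> i) ` ?M)"]) auto
    qed (use True in auto)
  next
    case False
    have "Max ((\<lambda>j. \<beta> j / \<alpha> j) ` ?N) \<le> \<beta> i / \<alpha> i" if i: "i \<in> ?M" for i
    proof -
      have "\<beta> j / \<alpha> j \<le> \<beta> i / \<alpha> i" if "j \<in> ?N" for j
        using R i that by (auto simp: field_simps)
      then show ?thesis
        using False assms by (subst Max_le_iff) auto
    qed
    then show ?thesis
      using assms by (intro exI[of _ "Max ((\<lambda>j. \<beta> j / \<alpha> j) ` ?N)"]) auto
  qed
  then obtain t where t: "\<And>j. j \<in> ?N \<Longrightarrow> \<beta> j / \<alpha> j \<le> t" "\<And>i. i \<in> ?M \<Longrightarrow> t \<le> \<beta> i / \<alpha> i"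
    by blast
  have "t * \<alpha> i \<le> \<beta> i" if "i \<in> I" for i
  proof (cases "\<alpha> i" "0::real" rule: linorder_cases)
    case less
    then show ?thesis using t(1)[of i] that by (simp add: field_simps)
  next
    case equal
    then show ?thesis using R that by auto
  next
    case greater
    then show ?thesis using t(2)[of i] that by (simp add: field_simps)
  qed
  then show ?L
    by blast
qed

(* One step of Fourier-Motzkin elimination, without coordinates. *)
lemma polyhedron_plus_line:
  fixes S :: "'a::euclidean_space set"
  assumes "polyhedron S"
  shows "polyhedron {x. \<exists>t. x + t *\<^sub>R v \<in> S}"
proof -
  obtain I where I: "finite I" "S = {x. \<forall>p\<in>I. fst p \<bullet> x \<le> snd p}"
    using assms by (auto simp: polyhedron_inequalities)
  let ?Z = "{p\<in>I. fst p \<bullet> v = 0}"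
  \<comment> \<open>\<open>?H p q\<close> is the combination of the inequalities \<open>p\<close>
    and \<open>q\<close> in which \<open>v\<close> cancels; its multipliers are positive when
    \<open>p\<close> and \<open>q\<close> have opposite signs on \<open>v\<close> as below.\<close>
  let ?H = "\<lambda>p q. {x. ((fst p \<bullet> v) *\<^sub>R fst q - (fst q \<bullet> v) *\<^sub>R fst p) \<bullet> x
    \<le> (fst p \<bullet> v) * snd q - (fst q \<bullet> v) * snd p}"
  have "x + t *\<^sub>R v \<in> S \<longleftrightarrow> (\<forall>p\<in>I. t * (fst p \<bullet> v) \<le> snd p - fst p \<bullet> x)" for x t
    using I(2) by (auto simp: inner_add_right algebra_simps)
  then have "(\<exists>t. x + t *\<^sub>R v \<in> S) \<longleftrightarrow>
      (\<forall>p\<in>I. fst p \<bullet> v = 0 \<longrightarrow> 0 \<le> snd p - fst p \<bullet> x) \<and>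
      (\<forall>p\<in>I. \<forall>q\<in>I. 0 < fst p \<bullet> v \<longrightarrow> fst q \<bullet> v < 0 \<longrightarrow>
        (fst q \<bullet> v) * (snd p - fst p \<bullet> x) \<le> (fst p \<bullet> v) * (snd q - fst q \<bullet> x))" for x
    by (simp add: scalar_inequalities_solvable_iff[OF I(1)])
  then have "{x. \<exists>t. x + t *\<^sub>R v \<in> S} = {x. \<forall>p\<in>?Z. fst p \<bullet> x \<le> snd p} \<inter>
    (\<Inter>p\<in>{p\<in>I. 0 < fst p \<bullet> v}. \<Inter>q\<in>{q\<in>I. fst q \<bullet> v < 0}. ?H p q)"
    by (simp add: set_eq_iff inner_diff_left algebra_simps del: split_paired_All) blast
  moreover have "polyhedron {x. \<forall>p\<in>?Z. fst p \<bullet> x \<le> snd p}"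
    by (rule polyhedron_halfspaces) (simp add: I(1))
  moreover have "polyhedron (\<Inter>p\<in>{p\<in>I. 0 < fst p \<bullet> v}. \<Inter>q\<in>{q\<in>I. fst q \<bullet> v < 0}. ?H p q)"
    using I(1) by (auto intro!: polyhedron_Inter polyhedron_halfspace_le)
  ultimately show ?thesis
    by (simp only: polyhedron_Int)
qed

lemma polyhedron_plus_span:
  fixes S :: "'a::euclidean_space set"
  assumes "polyhedron S" "finite B"
  shows "polyhedron {x. \<exists>v\<in>span B. x + v \<in> S}"
  using assms(2)
proof (induction B)
  case empty
  then show ?case using assms(1) by simp
next
  case (insert b B)
  have "(\<exists>v\<in>span (insert b B). x + v \<in> S) \<longleftrightarrow> (\<exists>t. \<exists>v\<in>span B. x + t *\<^sub>R b + v \<in> S)" for x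
  proof
    assume "\<exists>v\<in>span (insert b B). x + v \<in> S"
    then obtain v k where "x + v \<in> S" "v - k *\<^sub>R b \<in> span B"
      by (auto simp: span_insert)
    then show "\<exists>t. \<exists>v\<in>span B. x + t *\<^sub>R b + v \<in> S"
      by (intro exI[of _ k] bexI[of _ "v - k *\<^sub>R b"]) auto
  next
    assume "\<exists>t. \<exists>v\<in>span B. x + t *\<^sub>R b + v \<in> S"
    then obtain t v where "v \<in> span B" "x + t *\<^sub>R b + v \<in> S"
      by blast
    then show "\<exists>v\<in>span (insert b B). x + v \<in> S"
      by (intro bexI[of _ "t *\<^sub>R b + v"]) (auto simp: span_insert add.assoc intro!: exI[of _ t])
  qed
  then show ?case
    using polyhedron_plus_line[OF insert.IH, of b] by simp
qed

text \<open>A point \<open>x\<close> lies in the projection exactly when \<open>(x, 0)\<close> can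
  be moved into \<open>S\<close> along the vertical subspace, so the projection is a linear preimage
  of \<open>S\<close> plus that subspace.\<close>

lemma polyhedron_fst_image:
  fixes S :: "('a::euclidean_space \<times> 'b::euclidean_space) set"
  assumes "polyhedron S"
  shows "polyhedron (fst ` S)"
proof -
  let ?B = "(\<lambda>b. (0 :: 'a, b)) ` (Basis :: 'b set)"
  have lin: "linear (\<lambda>b. (0 :: 'a, b :: 'b))" "linear (\<lambda>x. (x :: 'a, 0 :: 'b))"
    by (auto intro!: linearI)
  have "span ?B = range (\<lambda>b. (0, b))"
    using linear_span_image[OF lin(1), of Basis] by (simp only: span_Basis)
  then have "{x. (x, 0) \<in> {z. \<exists>v\<in>span ?B. z + v \<in> S}} = {x. \<exists>b. (x, b) \<in> S}"
    by simp
  then have "fst ` S = {x. (x, 0) \<in> {z. \<exists>v\<in>span ?B. z + v \<in> S}}"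
    by (auto simp: image_iff Bex_def)
  also have "polyhedron \<dots>"
    by (rule polyhedron_linear_preimage[OF lin(2) polyhedron_plus_span[OF assms]]) simp
  finally show ?thesis .
qed

text \<open>The image is the projection of the graph of \<open>f\<close> over \<open>S\<close>, with
  the value stored first so that \<open>fst\<close> is the projection.\<close>

lemma polyhedron_linear_image:
  fixes f :: "'a::euclidean_space \<Rightarrow> 'b::euclidean_space"
  assumes "linear f" "polyhedron S"
  shows "polyhedron (f ` S)"
proof -
  have "linear (\<lambda>z. fst z - f (snd z) :: 'b)"
    using assms(1)
    by (intro linear_compose_sub linear_fst linear_compose[OF linear_snd, unfolded o_def])
  then have "polyhedron {z :: 'b \<times> 'a. fst z - f (snd z) \<in> {0}}"
    by (rule polyhedron_linear_preimage) (use affine_imp_polyhedron[of "{0::'b}"] in simp)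
  moreover have "polyhedron {z :: 'b \<times> 'a. snd z \<in> S}"
    by (rule polyhedron_linear_preimage[OF linear_snd assms(2)])
  ultimately have "polyhedron ({z :: 'b \<times> 'a. fst z - f (snd z) \<in> {0}} \<inter> {z. snd z \<in> S})"
    by (rule polyhedron_Int)
  moreover have "f ` S = fst ` ({z :: 'b \<times> 'a. fst z - f (snd z) \<in> {0}} \<inter> {z. snd z \<in> S})"
    (is "_ = fst ` ?G")
  proof (intro set_eqI iffI)
    fix y assume "y \<in> f ` S"
    then obtain x where "x \<in> S" "y = f x"
      by blast
    then show "y \<in> fst ` ?G"
      by (intro image_eqI[of _ _ "(y, x)"]) auto
  next
    fix y assume "y \<in> fst ` ?G"
    then obtain x where "y - f x = 0" "x \<in> S"
      by force
    then show "y \<in> f ` S"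
      by (simp add: image_eqI)
  qed
  ultimately show ?thesis
    by (metis polyhedron_fst_image)
qed

text \<open>The graph of the sum is the image of the product of the graph of \<open>F\<close> with
  \<open>C\<close> under the linear map \<open>((x, y), c)\<close> to
  \<open>(x, y + c)\<close>.\<close>

lemma polyhedral_map_plus:
  assumes "polyhedral_map F" "polyhedron C"
  shows "polyhedral_map (\<lambda>x. F x + C)"
proof -
  let ?f = "\<lambda>z. (fst (fst z), snd (fst z) + snd z)"
  have "setmap_graph (\<lambda>x. F x + C) = ?f ` ({z. fst z \<in> setmap_graph F} \<inter> {z. snd z \<in> C})"
    (is "_ = ?f ` ?S")
  proof (intro set_eqI iffI)
    fix z assume "z \<in> setmap_graph (\<lambda>x. F x + C)"
    then obtain x y c where "z = ?f ((x, y), c)" "y \<in> F x" "c \<in> C"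
      by (auto simp: setmap_graph_def set_plus_def)
    then show "z \<in> ?f ` ?S"
      by (intro image_eqI[of _ _ "((x, y), c)"]) (auto simp: setmap_graph_def)
  next
    fix z assume "z \<in> ?f ` ?S"
    then obtain x y c where "z = (x, y + c)" "y \<in> F x" "c \<in> C"
      by (force simp: setmap_graph_def)
    then show "z \<in> setmap_graph (\<lambda>x. F x + C)"
      by (auto simp: setmap_graph_def)
  qed
  also have "polyhedron \<dots>"
  proof (rule polyhedron_linear_image)
    show "linear ?f"
      by (rule linearI) (auto simp: scaleR_add_right)
    show "polyhedron ?S"
      using assms polyhedron_linear_preimage[OF linear_fst] polyhedron_linear_preimage[OF linear_snd]
      unfolding polyhedral_map_def by (intro polyhedron_Int)
  qed
  finally show ?thesis
    by (simp add: polyhedral_map_def)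
qed

section \<open>Farkas' lemma and solvability of the linear programs\<close>

section \<open>Existence of optimal solutions\<close>

(* Farkas' lemma: a functional outside the (polyhedral) cone of the constraint normals is
   separated from it by one of the inequalities describing that cone. *)
lemma linear_functional_bounded_or_recession:
  fixes w :: "'a::euclidean_space"
  assumes "finite I"
  shows "(\<exists>\<gamma>. \<forall>z. (\<forall>p\<in>I. fst p \<bullet> z \<le> snd p) \<longrightarrow> w \<bullet> z \<le> \<gamma>) \<or>
    (\<exists>d. (\<forall>p\<in>I. fst p \<bullet> d \<le> 0) \<and> 0 < w \<bullet> d)"
proof (cases "w \<in> convex_cone hull (fst ` I)")
  case True
  define M where "M = {z. \<forall>p\<in>I. fst p \<bullet> z \<le> snd p}"
  \<comment> \<open>The functionals bounded above on \<open>M\<close> form a convex cone containing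
    all constraint normals, hence also \<open>w\<close>.\<close>
  define K where "K = {v. \<exists>\<gamma>. \<forall>z\<in>M. v \<bullet> z \<le> \<gamma>}"
  have add: "u + v \<in> K" if uv: "u \<in> K" "v \<in> K" for u v
  proof -
    obtain \<gamma> \<delta> where "\<forall>z\<in>M. u \<bullet> z \<le> \<gamma>" "\<forall>z\<in>M. v \<bullet> z \<le> \<delta>"
      using uv K_def by blast
    then have "\<forall>z\<in>M. (u + v) \<bullet> z \<le> \<gamma> + \<delta>"
      by (simp add: inner_add_left add_mono)
    then show ?thesis
      unfolding K_def by blast
  qed
  have scale: "c *\<^sub>R v \<in> K" if vc: "v \<in> K" "0 \<le> c" for v c
  proof -
    obtain \<gamma> where "\<forall>z\<in>M. v \<bullet> z \<le> \<gamma>"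
      using vc K_def by blast
    then have "\<forall>z\<in>M. (c *\<^sub>R v) \<bullet> z \<le> c * \<gamma>"
      using vc by (simp add: mult_left_mono)
    then show ?thesis
      unfolding K_def by blast
  qed
  have "fst ` I \<subseteq> K"
    by (auto simp: K_def M_def)
  moreover have "0 \<in> K"
    by (auto simp: K_def)
  then have "convex_cone K"
    using add scale by (simp add: convex_cone_iff)
  ultimately have "w \<in> K"
    using True hull_minimal[of "fst ` I" K convex_cone] by blast
  then show ?thesis
    by (auto simp: K_def M_def)
next
  case False
  let ?K = "convex_cone hull (fst ` I)"
  have "polyhedron ?K"
    using assms by (simp add: polyhedron_convex_cone_hull)
  then obtain J where J: "?K = {x. \<forall>p\<in>J. fst p \<bullet> x \<le> snd p}"
    by (auto simp: polyhedron_inequalities)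
  \<comment> \<open>The normal of an inequality of the cone that \<open>w\<close> violates is the
    required direction.\<close>
  with False obtain q where q: "q \<in> J" "snd q < fst q \<bullet> w"
    by force
  have "0 \<le> snd q"
    using convex_cone_hull_contains_0[of "fst ` I"] q(1) J by fastforce
  then have "0 < w \<bullet> fst q"
    using q(2) by (simp add: inner_commute)
  moreover have "fst p \<bullet> fst q \<le> 0" if "p \<in> I" for p
  proof (rule ccontr)
    assume pos: "\<not> fst p \<bullet> fst q \<le> 0"
    \<comment> \<open>Scaled so that the inner product with \<open>fst q\<close> is
      \<open>snd q + 1\<close>, which violates \<open>q\<close> inside the cone.\<close>
    let ?t = "(snd q + 1) / (fst p \<bullet> fst q)"
    have "?t *\<^sub>R fst p \<in> ?K"
      using pos \<open>0 \<le> snd q\<close> that by (intro convex_cone_hull_mul hull_inc) auto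
    then have "fst q \<bullet> (?t *\<^sub>R fst p) \<le> snd q"
      using J q(1) by blast
    then show False
      using pos by (simp add: inner_commute)
  qed
  ultimately show ?thesis by blast
qed

text \<open>The values of the functional form a polyhedron in the real line, which is closed and so
  contains its supremum.\<close>

lemma polyhedron_attains_max:
  fixes S :: "'a::euclidean_space set"
  assumes "polyhedron S" "S \<noteq> {}" "\<And>z. z \<in> S \<Longrightarrow> w \<bullet> z \<le> \<gamma>"
  shows "\<exists>z\<in>S. \<forall>z'\<in>S. w \<bullet> z' \<le> w \<bullet> z"
proof -
  let ?T = "(\<lambda>z. w \<bullet> z) ` S"
  have "polyhedron ?T"
    by (intro polyhedron_linear_image assms(1) bounded_linear.linear bounded_linear_inner_right)
  then have "closed ?T"
    by (rule polyhedron_imp_closed)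
  moreover have bdd: "bdd_above ?T"
    using assms(3) by (auto intro!: bdd_aboveI)
  ultimately have "Sup ?T \<in> ?T"
    using assms(2) by (intro closed_contains_Sup) auto
  then obtain z where "z \<in> S" "Sup ?T = w \<bullet> z"
    by blast
  then show ?thesis
    using bdd by (metis cSup_upper imageI)
qed

text \<open>A solution of (P) enters only through one minimizing value, at \<open>xm\<close>. The
  bound \<open>bnd\<close> is later read off from the inequalities representing the affine
  hull.\<close>

lemma lp_optimal_exists:
  fixes F :: "'a::euclidean_space \<Rightarrow> 'b::euclidean_space set"
  assumes poly: "polyhedral_map F" "polyhedron C"
    and min: "F xm + C \<noteq> {}" "\<nexists>x. F x + C \<supset> F xm + C"
    and ne: "F xbar + C \<noteq> {}"
    and bnd: "\<And>y. y \<in> F xbar + C \<Longrightarrow> w \<bullet> y \<le> \<gamma>"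
  shows "\<exists>p. lp_optimal F C w xbar p"
proof -
  define H where "H x = F x + C" for x
  have "polyhedron (setmap_graph H)"
    using polyhedral_map_plus[OF poly] unfolding polyhedral_map_def H_def .
  then obtain I where I: "finite I"
    and graph: "setmap_graph H = {z. \<forall>p\<in>I. fst p \<bullet> z \<le> snd p}"
    by (auto simp: polyhedron_inequalities)
  have H: "y \<in> H x \<longleftrightarrow> (\<forall>p\<in>I. fst (fst p) \<bullet> x + snd (fst p) \<bullet> y \<le> snd p)" for x y
    using graph by (auto simp: setmap_graph_def set_eq_iff inner_prod_def)
  obtain y0 where y0: "y0 \<in> H xbar"
    using ne H_def by blast
  \<comment> \<open>Support function of \<open>H xbar\<close> in the \<open>y\<close>-part of a
    normal. For \<open>p\<close> in \<open>I\<close> it is a genuine supremum, since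
    \<open>p\<close> itself bounds that functional on the nonempty set
    \<open>H xbar\<close>.\<close>
  define \<sigma> where "\<sigma> p = Sup ((\<bullet>) (snd (fst p)) ` H xbar)" for p :: "('a \<times> 'b) \<times> real"
  have \<sigma>: "\<sigma> p \<le> s \<longleftrightarrow> (\<forall>y\<in>H xbar. snd (fst p) \<bullet> y \<le> s)" if "p \<in> I" for p s
  proof -
    have "snd (fst p) \<bullet> y \<le> snd p - fst (fst p) \<bullet> xbar" if "y \<in> H xbar" for y
      using H that \<open>p \<in> I\<close> by fastforce
    then have "bdd_above ((\<bullet>) (snd (fst p)) ` H xbar)"
      by (auto intro!: bdd_aboveI)
    then show ?thesis
      unfolding \<sigma>_def using y0 by (subst cSup_le_iff) auto
  qed
  have incl: "H xbar \<subseteq> H x \<longleftrightarrow> (\<forall>p\<in>I. fst (fst p) \<bullet> x \<le> snd p - \<sigma> p)" for x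
  proof -
    have "y \<in> H x \<longleftrightarrow> (\<forall>p\<in>I. snd (fst p) \<bullet> y \<le> snd p - fst (fst p) \<bullet> x)" for y
      by (simp add: H algebra_simps)
    then have "H xbar \<subseteq> H x \<longleftrightarrow> (\<forall>p\<in>I. \<forall>y\<in>H xbar. snd (fst p) \<bullet> y \<le> snd p - fst (fst p) \<bullet> x)"
      by blast
    also have "\<dots> \<longleftrightarrow> (\<forall>p\<in>I. \<sigma> p \<le> snd p - fst (fst p) \<bullet> x)"
      using \<sigma> by simp
    finally show ?thesis
      by (simp add: algebra_simps)
  qed
  \<comment> \<open>The first part encodes \<open>y \<in> H x\<close>; the second, with zero
    \<open>y\<close>-part, encodes the inclusion of \<open>H xbar\<close> in
    \<open>H x\<close>.\<close>
  define J where "J = I \<union> (\<lambda>p. ((fst (fst p), 0), snd p - \<sigma> p)) ` I"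
  have "finite J"
    using I J_def by simp
  have feas: "lp_feasible F C xbar = {z. \<forall>p\<in>J. fst p \<bullet> z \<le> snd p}"
  proof -
    have "z \<in> lp_feasible F C xbar \<longleftrightarrow> snd z \<in> H (fst z) \<and> H xbar \<subseteq> H (fst z)" for z
      by (cases z) (simp add: lp_feasible_def H_def)
    then show ?thesis
      unfolding incl H J_def set_eq_iff mem_Collect_eq
      by (simp add: ball_Un inner_prod_def del: split_paired_All)
  qed
  have "\<nexists>d. (\<forall>p\<in>J. fst p \<bullet> d \<le> 0) \<and> 0 < (0, w) \<bullet> d"
  proof
    assume "\<exists>d. (\<forall>p\<in>J. fst p \<bullet> d \<le> 0) \<and> 0 < (0, w) \<bullet> d"
    then obtain d e where d: "\<forall>p\<in>I. fst (fst p) \<bullet> d \<le> 0"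
      and de: "\<forall>p\<in>I. fst (fst p) \<bullet> d + snd (fst p) \<bullet> e \<le> 0" and w: "0 < w \<bullet> e"
      by (auto simp: J_def inner_prod_def ball_Un)
    obtain y1 where y1: "y1 \<in> H xm"
      using min(1) H_def by blast
    (* The values only grow along d, so minimality of xm makes them constant, and e becomes a
       recession direction of H xm, hence of every nonempty value of H. *)
    have const: "H (xm + t *\<^sub>R d) = H xm" if "0 \<le> t" for t
    proof -
      have "fst (fst p) \<bullet> (xm + t *\<^sub>R d) \<le> fst (fst p) \<bullet> xm" if "p \<in> I" for p
        using d that \<open>0 \<le> t\<close> by (simp add: inner_add_right mult_nonneg_nonpos)
      then have "H xm \<subseteq> H (xm + t *\<^sub>R d)"
        by (intro subsetI) (fastforce simp: H intro: order_trans[OF add_right_mono])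
      then show ?thesis
        using min(2) H_def by blast
    qed
    have ray: "y1 + t *\<^sub>R e \<in> H xm" if "0 \<le> t" for t
    proof -
      have "fst (fst p) \<bullet> (xm + t *\<^sub>R d) + snd (fst p) \<bullet> (y1 + t *\<^sub>R e) \<le> snd p"
        if "p \<in> I" for p
      proof -
        have "t * (fst (fst p) \<bullet> d + snd (fst p) \<bullet> e) \<le> 0"
          using de that \<open>0 \<le> t\<close> by (simp add: mult_nonneg_nonpos)
        then show ?thesis
          using y1 that unfolding H by (fastforce simp: inner_add_right algebra_simps)
      qed
      then show ?thesis
        using const[OF that] H by blast
    qed
    have e: "snd (fst p) \<bullet> e \<le> 0" if "p \<in> I" for p
    proof (rule ccontr)
      assume pos: "\<not> snd (fst p) \<bullet> e \<le> 0"
      \<comment> \<open>\<open>?s\<close> is the slack of \<open>p\<close> at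
        \<open>(xm, y1)\<close>, and the step \<open>?t\<close> along \<open>e\<close> would
        overshoot it by one.\<close>
      let ?s = "snd p - fst (fst p) \<bullet> xm - snd (fst p) \<bullet> y1"
      let ?t = "(?s + 1) / (snd (fst p) \<bullet> e)"
      have "0 \<le> ?s"
        using y1 that unfolding H by fastforce
      then have "y1 + ?t *\<^sub>R e \<in> H xm"
        using pos by (intro ray) auto
      then have "fst (fst p) \<bullet> xm + snd (fst p) \<bullet> (y1 + ?t *\<^sub>R e) \<le> snd p"
        using that unfolding H by blast
      then show False
        using pos by (simp add: inner_add_right)
    qed
    \<comment> \<open>Chosen so that \<open>w\<close> takes the value \<open>\<gamma> + 1\<close> at
      \<open>y0 + ?t *\<^sub>R e\<close>, a point that stays in \<open>H xbar\<close>.\<close>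
    let ?t = "(\<gamma> - w \<bullet> y0 + 1) / (w \<bullet> e)"
    have "0 \<le> ?t"
      using bnd[of y0] y0 w by (simp add: H_def)
    then have "fst (fst p) \<bullet> xbar + snd (fst p) \<bullet> (y0 + ?t *\<^sub>R e) \<le> snd p" if "p \<in> I" for p
    proof -
      have "?t * (snd (fst p) \<bullet> e) \<le> 0"
        using \<open>0 \<le> ?t\<close> e[OF that] by (rule mult_nonneg_nonpos)
      moreover have "fst (fst p) \<bullet> xbar + snd (fst p) \<bullet> y0 \<le> snd p"
        using y0 that H by blast
      ultimately show ?thesis
        by (simp only: inner_add_right inner_scaleR_right)
    qed
    then have "w \<bullet> (y0 + ?t *\<^sub>R e) \<le> \<gamma>"
      using bnd H_def H by blast
    then show False
      using w by (simp add: inner_add_right)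
  qed
  then obtain \<delta> where "\<forall>z\<in>lp_feasible F C xbar. (0, w) \<bullet> z \<le> \<delta>"
    using linear_functional_bounded_or_recession[OF \<open>finite J\<close>, of "(0, w)"] feas by blast
  moreover have "polyhedron (lp_feasible F C xbar)"
    unfolding feas by (rule polyhedron_halfspaces) fact
  moreover have "(xbar, y0) \<in> lp_feasible F C xbar"
    using y0 by (simp add: lp_feasible_def H_def)
  ultimately have "\<exists>z\<in>lp_feasible F C xbar. \<forall>z'\<in>lp_feasible F C xbar. (0, w) \<bullet> z' \<le> (0, w) \<bullet> z"
    by (intro polyhedron_attains_max) auto
  then show ?thesis
    by (simp add: lp_optimal_def inner_prod_def del: split_paired_Ex) blast
qed

section \<open>Existence of the systems chosen by the outer loop\<close>

section \<open>Minimal systems of outer normals\<close>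

lemma normal_representation_exists:
  fixes Q :: "'b::euclidean_space set"
  assumes "polyhedron Q" "Q \<noteq> {}"
  shows "\<exists>ws gs. normal_representation Q ws gs"
proof -
  obtain I where I: "finite I" "Q = {y. \<forall>p\<in>I. fst p \<bullet> y \<le> snd p}"
    using assms(1) by (auto simp: polyhedron_inequalities)
  have trivial: "0 \<le> snd p" if "p \<in> I" "fst p = 0" for p
    using assms(2) I(2) that by fastforce
  obtain ps where ps: "set ps = {p\<in>I. fst p \<noteq> 0}"
    using I(1) finite_list[of "{p\<in>I. fst p \<noteq> 0}"] by auto
  have "y \<in> Q \<longleftrightarrow> (\<forall>p\<in>set ps. y \<bullet> (fst p /\<^sub>R norm (fst p)) \<le> snd p / norm (fst p))" for y
  proof -
    have "y \<in> Q \<longleftrightarrow> (\<forall>p\<in>set ps. fst p \<bullet> y \<le> snd p)"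
      using I(2) ps trivial by force
    also have "\<dots> \<longleftrightarrow> (\<forall>p\<in>set ps. y \<bullet> (fst p /\<^sub>R norm (fst p)) \<le> snd p / norm (fst p))"
      using ps by (intro ball_cong) (auto simp: field_simps inner_commute)
    finally show ?thesis .
  qed
  then have "Q = {y. \<forall>i<length ps. y \<bullet> (fst (ps ! i) /\<^sub>R norm (fst (ps ! i)))
      \<le> snd (ps ! i) / norm (fst (ps ! i))}"
    unfolding all_set_conv_all_nth by blast
  then have "normal_representation Q (map (\<lambda>p. fst p /\<^sub>R norm (fst p)) ps)
      (map (\<lambda>p. snd p / norm (fst p)) ps)"
    using ps by (simp add: normal_representation_def)
  then show ?thesis by blast
qed

lemma minimal_outer_normals_exists:
  fixes Q :: "'b::euclidean_space set"
  assumes "polyhedron Q" "Q \<noteq> {}"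
  shows "\<exists>ws. minimal_outer_normals Q ws"
  using ex_has_least_nat[of "\<lambda>ws. \<exists>gs. normal_representation Q ws gs" _ length]
    normal_representation_exists[OF assms]
  unfolding minimal_outer_normals_def by metis

section \<open>Loop invariant, ranking functions and absence of stuck states\<close>

section \<open>Termination and correctness\<close>

(* The normals already processed have been kept, so the linear programs for them have an
   optimal solution in the affine hull. *)
fun affine_start_inv ::
    "('a \<Rightarrow> 'b::euclidean_space set) \<Rightarrow> 'b set \<Rightarrow> 'b \<Rightarrow> ('a, 'b) affine_start_state \<Rightarrow> bool" where
  "affine_start_inv F C ybar Start \<longleftrightarrow> True"
| "affine_start_inv F C ybar (Outer xbar) \<longleftrightarrow> ybar \<in> F xbar + C"
| "affine_start_inv F C ybar (Inner xbar ws) \<longleftrightarrow> ybar \<in> F xbar + C \<and>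
    (\<exists>N gs. normal_representation (affine hull (F xbar + C)) N gs \<and> set ws \<subseteq> set N \<and>
      (\<forall>w\<in>set N - set ws. \<exists>p. lp_optimal F C w xbar p \<and> snd p \<in> affine hull (F xbar + C)))"
| "affine_start_inv F C ybar (Output F' xbar) \<longleftrightarrow> ybar \<in> F xbar + C \<and>
    (\<nexists>x. F x + C \<supseteq> F xbar + C \<and> aff_dim (F x + C) > aff_dim (F xbar + C))"

text \<open>Every \<open>y\<close> in \<open>F x + C\<close> gives a feasible point
  \<open>(x, y)\<close>, so each normal at \<open>y\<close> is at most its optimal value. That value
  is attained in the affine hull and hence respects the bound in \<open>gs\<close>, which puts
  \<open>y\<close> in the affine hull.\<close>

lemma no_larger_dim_if_all_kept:
  assumes rep: "normal_representation (affine hull (F xbar + C)) N gs"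
    and kept: "\<forall>w\<in>set N. \<exists>p. lp_optimal F C w xbar p \<and> snd p \<in> affine hull (F xbar + C)"
    and sub: "F xbar + C \<subseteq> F x + C"
  shows "aff_dim (F x + C) \<le> aff_dim (F xbar + C)"
proof -
  let ?A = "affine hull (F xbar + C)"
  have A: "?A = {y. \<forall>i<length N. y \<bullet> N ! i \<le> gs ! i}"
    using rep by (simp add: normal_representation_def)
  have "y \<in> ?A" if y: "y \<in> F x + C" for y
  proof -
    have "y \<bullet> N ! i \<le> gs ! i" if i: "i < length N" for i
    proof -
      obtain p where p: "lp_optimal F C (N ! i) xbar p" "snd p \<in> ?A"
        using kept i by force
      have "(x, y) \<in> lp_feasible F C xbar"
        using y sub by (simp add: lp_feasible_def)
      then have "N ! i \<bullet> y \<le> N ! i \<bullet> snd p"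
        using p(1) by (force simp: lp_optimal_def)
      also have "\<dots> \<le> gs ! i"
        using p(2) i A by (simp add: inner_commute)
      finally show ?thesis
        by (simp add: inner_commute)
    qed
    then show ?thesis
      unfolding A by blast
  qed
  then have "aff_dim (F x + C) \<le> aff_dim ?A"
    by (intro aff_dim_subset) blast
  then show ?thesis
    by simp
qed

lemma affine_start_inv_step:
  assumes "affine_start_step F C ybar s s'" "affine_start_inv F C ybar s"
  shows "affine_start_inv F C ybar s'"
  using assms
proof cases
  case (normals xbar N)
  then show ?thesis
    using assms(2) by (auto simp: minimal_outer_normals_def)
next
  case (keep w xbar xs ys ws)
  obtain N gs where N: "normal_representation (affine hull (F xbar + C)) N gs" "set (w # ws) \<subseteq> set N"
    "\<forall>v\<in>set N - set (w # ws). \<exists>p. lp_optimal F C v xbar p \<and> snd p \<in> affine hull (F xbar + C)"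
    and "ybar \<in> F xbar + C"
    using assms(2) keep(1) by auto
  moreover have "\<exists>p. lp_optimal F C w xbar p \<and> snd p \<in> affine hull (F xbar + C)"
    using keep by (metis snd_conv)
  ultimately show ?thesis
    unfolding keep(2) affine_start_inv.simps by (intro conjI exI[of _ N] exI[of _ gs]) auto
next
  \<comment> \<open>Feasibility of \<open>(xs, ys)\<close> includes
    \<open>F xbar + C \<subseteq> F xs + C\<close>, so \<open>ybar\<close> stays covered.\<close>
  case (replace w xbar xs ys ws)
  then show ?thesis
    using assms(2) by (auto simp: lp_optimal_def lp_feasible_def)
next
  \<comment> \<open>With no normals left to process, the invariant says that all of \<open>N\<close>
    were kept.\<close>
  case (finish xbar)
  then show ?thesis
    using assms(2) no_larger_dim_if_all_kept[of F xbar C] by (fastforce simp: not_less)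
qed auto

lemma affine_start_inv_reachable:
  assumes "affine_start_reachable F C ybar s"
  shows "affine_start_inv F C ybar s"
  using assms unfolding affine_start_reachable_def
  by (induction rule: rtranclp_induct) (auto intro: affine_start_inv_step)

text \<open>As \<open>aff_dim\<close> ranges from -1 to \<open>DIM('b)\<close>, the loop states have
  ranks from 2 to \<open>DIM('b) + 3\<close>, strictly between those of \<open>Output\<close> and
  \<open>Start\<close>.\<close>

fun codim_rank ::
    "('a \<Rightarrow> 'b::euclidean_space set) \<Rightarrow> 'b set \<Rightarrow> ('a, 'b) affine_start_state \<Rightarrow> nat" where
  "codim_rank F C Start = DIM('b) + 4"
| "codim_rank F C (Outer xbar) = nat (int DIM('b) + 2 - aff_dim (F xbar + C))"
| "codim_rank F C (Inner xbar ws) = nat (int DIM('b) + 2 - aff_dim (F xbar + C))"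
| "codim_rank F C (Output F' xbar) = 0"

fun loop_rank :: "('a, 'b) affine_start_state \<Rightarrow> nat" where
  "loop_rank (Inner xbar ws) = length ws"
| "loop_rank _ = 0"

text \<open>Compensates for the choice of normals, which keeps \<open>codim_rank\<close> but may
  raise \<open>loop_rank\<close> from 0 to the length of the list.\<close>

definition outer_rank :: "('a, 'b) affine_start_state \<Rightarrow> nat" where
  "outer_rank s = (case s of Outer _ \<Rightarrow> 1 | _ \<Rightarrow> 0)"

text \<open>Lexicographic descent: \<open>choose\<close>, \<open>replace\<close> and
  \<open>finish\<close> lower the first rank, \<open>normals\<close> the second, \<open>keep\<close>
  the third.\<close>

lemma affine_start_step_decreases:
  fixes F :: "'a \<Rightarrow> 'b::euclidean_space set"
  assumes "affine_start_step F C ybar s s'"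
  shows "(s', s) \<in> measures [codim_rank F C, outer_rank, loop_rank]"
  using assms
proof cases
  case (choose xbar)
  have "nat (int DIM('b) + 2 - aff_dim (F xbar + C)) < DIM('b) + 4"
    using aff_dim_geq[of "F xbar + C"] by linarith
  with choose show ?thesis
    by simp
next
  case (normals xbar N)
  then show ?thesis by (simp add: outer_rank_def)
next
  case (keep w xbar xs ys ws)
  then show ?thesis by (simp add: outer_rank_def)
next
  case (replace w xbar xs ys ws)
  have "F xbar + C \<subseteq> F xs + C" "ys \<in> F xs + C"
    using replace by (auto simp: lp_optimal_def lp_feasible_def)
  \<comment> \<open>Strictness is witnessed by \<open>ys\<close>, which lies in the new affine hull
    but not in the old one.\<close>
  then have "affine hull (F xbar + C) \<subset> affine hull (F xs + C)"
    using replace(4) hull_mono hull_inc by (metis psubsetI)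
  then have "aff_dim (F xbar + C) < aff_dim (F xs + C)"
    by (rule aff_dim_psubset)
  then show ?thesis
    using replace aff_dim_le_DIM[of "F xs + C"] by simp
next
  case (finish xbar)
  then show ?thesis
    using aff_dim_le_DIM[of "F xbar + C"] by simp
qed

lemma affine_start_progress:
  fixes F :: "'a::euclidean_space \<Rightarrow> 'b::euclidean_space set"
  assumes poly: "polyhedral_map F" "polyhedron C"
    and min: "F xm + C \<noteq> {}" "\<nexists>x. F x + C \<supset> F xm + C"
    and ybar: "ybar \<in> upper_image F C"
    and inv: "affine_start_inv F C ybar s"
  shows "(\<exists>F' xbar. s = Output F' xbar) \<or> (\<exists>s'. affine_start_step F C ybar s s')"
proof (cases s)
  case Start
  obtain c x y where "ybar = c + y" "c \<in> C" "y \<in> F x"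
    using ybar by (auto simp: upper_image_def set_plus_def)
  then have "ybar \<in> F x + C"
    by (simp add: add.commute[of c] set_plus_intro)
  then show ?thesis
    using Start by (blast intro: affine_start_step.choose)
next
  case (Outer xbar)
  have "affine hull (F xbar + C) \<noteq> {}"
    using inv Outer by auto
  then obtain N where "minimal_outer_normals (affine hull (F xbar + C)) N"
    using minimal_outer_normals_exists[OF polyhedron_affine_hull] by blast
  then show ?thesis
    using Outer by (blast intro: affine_start_step.normals)
next
  case (Inner xbar ws)
  show ?thesis
  proof (cases ws)
    case Nil
    then show ?thesis
      using Inner by (blast intro: affine_start_step.finish)
  next
    case (Cons w ws')
    obtain N gs where rep: "normal_representation (affine hull (F xbar + C)) N gs"
      and "w \<in> set N" and "F xbar + C \<noteq> {}"
      using inv Inner Cons by auto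
    then obtain i where "i < length N" "w = N ! i"
      by (metis in_set_conv_nth)
    \<comment> \<open>By the invariant \<open>w\<close> belongs to a representing system, so its
      bound on the affine hull supplies the hypothesis \<open>bnd\<close> for the linear
      program.\<close>
    then have "w \<bullet> y \<le> gs ! i" if "y \<in> F xbar + C" for y
      using rep hull_inc[OF that, of affine]
      by (auto simp: normal_representation_def inner_commute)
    then obtain xs ys where "lp_optimal F C w xbar (xs, ys)"
      using lp_optimal_exists[OF poly min \<open>F xbar + C \<noteq> {}\<close>] by (metis surj_pair)
    then show ?thesis
      using Inner Cons by (blast intro: affine_start_step.keep affine_start_step.replace)
  qed
qed auto

text \<open>Finiteness is split in two: no infinite run, and no stuck reachable state besides an
  output, which covers solvability of the linear programs. Together they make every maximal run end
  in an output.\<close>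

theorem proposition7p1:
  fixes F :: "real ^ 'n \<Rightarrow> (real ^ 'q) set"
    and C :: "(real ^ 'q) set"
    and ybar :: "real ^ 'q"
  assumes "polyhedral_map F"
    and "polyhedral_cone C"
    and "\<exists>Sbar Shat. is_solution F C Sbar Shat"
    and "ybar \<in> upper_image F C"
  shows "(\<nexists>s :: nat \<Rightarrow> (real ^ 'n, real ^ 'q) affine_start_state.
            s 0 = Start \<and> (\<forall>i. affine_start_step F C ybar (s i) (s (Suc i))))
       \<and> (\<forall>s. affine_start_reachable F C ybar s \<longrightarrow>
            (\<exists>F' xbar. s = Output F' xbar) \<or> (\<exists>s'. affine_start_step F C ybar s s'))
       \<and> (\<forall>F' xbar. affine_start_reachable F C ybar (Output F' xbar) \<longrightarrow>
            ybar \<in> F xbar + C \<and>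
            \<not> (\<exists>x. F x + C \<supseteq> F xbar + C \<and> aff_dim (F x + C) > aff_dim (F xbar + C)))"
proof -
  have "\<nexists>s :: nat \<Rightarrow> (real ^ 'n, real ^ 'q) affine_start_state.
      s 0 = Start \<and> (\<forall>i. affine_start_step F C ybar (s i) (s (Suc i)))"
    using wf_measures[of "[codim_rank F C, outer_rank, loop_rank]"] affine_start_step_decreases
    unfolding wf_iff_no_infinite_down_chain by metis
  moreover have C: "polyhedron C" "C \<noteq> {}"
    using assms(2) by (auto simp: polyhedral_cone_def convex_cone_def)
  \<comment> \<open>\<open>Sbar\<close> is nonempty in a finite infimizer, and in a solution its
    elements are minimizing points.\<close>
  obtain xm where xm: "minimizing_point F C xm"
    using assms(3) unfolding is_solution_def finite_infimizer_def by blast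
  then have "F xm + C \<noteq> {}" "\<nexists>x. F x + C \<supset> F xm + C"
    using C(2) by (auto simp: minimizing_point_def setmap_dom_def simp flip: ex_in_conv
        intro: set_plus_intro)
  then have "(\<exists>F' xbar. s = Output F' xbar) \<or> (\<exists>s'. affine_start_step F C ybar s s')"
    if "affine_start_reachable F C ybar s" for s
    using affine_start_progress[OF assms(1) C(1) _ _ assms(4)] affine_start_inv_reachable[OF that]
    by blast
  moreover have "ybar \<in> F xbar + C \<and>
      \<not> (\<exists>x. F x + C \<supseteq> F xbar + C \<and> aff_dim (F x + C) > aff_dim (F xbar + C))"
    if "affine_start_reachable F C ybar (Output F' xbar)" for F' xbar
    using affine_start_inv_reachable[OF that] by simp
  ultimately show ?thesis
    by blast
qed

end
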